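(* Let $(X_i,\leqslant_i)$, $i\in\{1,\dots,n\}$, be a finite family of partially ordered sets, let $(\Lambda,\leqslant)$ be a totally ordered set, let $u:\prod_{i=1}^n X_i\to\Lambda$ be an individually quasi-Leontief function, and let $S_i\subset X_i$, $i\in\{1,\dots,n\}$, be comprehensive subsets. Let $S=\prod_{i=1}^n S_i$. If $\arg\max(u;S)\neq\emptyset$ then, for every $x^\star\in\arg\max(u;S)$, there exists $x^\flat\in\arg\max(u;S)$ such that $x^\flat$ is efficient for $u$ and $x^\star\geqslant x^\flat$.
   Context: The product $\prod_i X_i$ carries the coordinatewise partial order. A function $v:Y\to\Lambda$ from a partially ordered set $Y$ to a totally ordered set $\Lambda$ is quasi-Leontief if for every $y\in Y$ there is $y^\circ\in Y$ with $\{y'\in Y: v(y')\geqslant v(y)\}=\{y'\in Y: y'\geqslant y^\circ\}$. For $x\in\prod_i X_i$, $x_{-j}\in\prod_{i\ne j}X_i$ is obtained from $x$ by deleting $x_j$, and one writes $x=(x_{-j},x_j)$. For $x_{-j}\in\prod_{i\neq j}X_i$, $u[x_{-j}]:X_j\to\Lambda$ is the function $u[x_{-j}](x_j)=u(x_{-j},x_j)$. The function $u:\prod_i X_i\to\Lambda$ is individually quasi-Leontief if for all $j$ and all $x_{-j}\in\prod_{i\neq j}X_i$ the function $u[x_{-j}]$ is quasi-Leontief. A point $x\in\prod_i X_i$ is efficient for $u$ (in the product sense) if it is a minimal element of $\{x'\in\prod_i X_i: u(x')\geqslant u(x)\}$, i.e. for all $x'\in\prod_i X_i$, $u(x')\geqslant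 u(x)$ and $x\geqslant x'$ imply $x'=x$. A subset $S$ of a partially ordered set is comprehensive if $x'\in S$ and $x\leqslant x'$ imply $x\in S$. $\arg\max(u;S)=\{x\in S: u(x)\geqslant u(x')\text{ for all }x'\in S\}$. *)

theory Defs
  imports Main "HOL-Library.FuncSet"
begin

text \<open>
  A partially ordered set is a carrier \<open>Y\<close> with a relation \<open>r\<close> such that
  \<open>partial_order_on Y r\<close>; the pair \<open>(x, y) \<in> r\<close> means \<open>x \<le> y\<close>. Different members of
  a family of posets may thus have different carriers and different orders inside one
  ambient type. The product of the carriers \<open>X i\<close>, \<open>i \<in> I\<close>, is \<open>PiE I X\<close>.
\<close>

definition prod_order :: "'i set \<Rightarrow> ('i \<Rightarrow> 'a set) \<Rightarrow> ('i \<Rightarrow> 'a rel) \<Rightarrow> ('i \<Rightarrow> 'a) rel" where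
  "prod_order I X r = {(x, y). x \<in> PiE I X \<and> y \<in> PiE I X \<and> (\<forall>i\<in>I. (x i, y i) \<in> r i)}"

definition quasi_leontief :: "'a set \<Rightarrow> 'a rel \<Rightarrow> ('a \<Rightarrow> 'l::linorder) \<Rightarrow> bool" where
  "quasi_leontief Y r v \<longleftrightarrow>
    (\<forall>y\<in>Y. \<exists>y0\<in>Y. {y'\<in>Y. v y' \<ge> v y} = {y'\<in>Y. (y0, y') \<in> r})"

text \<open>
  An element \<open>z \<in> PiE (I - {j}) X\<close> is a tuple \<open>x\<^sub>-\<^sub>j\<close> with the \<open>j\<close>-th coordinate deleted;
  \<open>z(j := t)\<close> is the full tuple \<open>(x\<^sub>-\<^sub>j, t) \<in> PiE I X\<close>.
\<close>

definition partial_function_at ::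
    "(('i \<Rightarrow> 'a) \<Rightarrow> 'l) \<Rightarrow> 'i \<Rightarrow> ('i \<Rightarrow> 'a) \<Rightarrow> 'a \<Rightarrow> 'l" where
  "partial_function_at u j z = (\<lambda>t. u (z(j := t)))"

definition individually_quasi_leontief ::
    "'i set \<Rightarrow> ('i \<Rightarrow> 'a set) \<Rightarrow> ('i \<Rightarrow> 'a rel) \<Rightarrow> (('i \<Rightarrow> 'a) \<Rightarrow> 'l::linorder) \<Rightarrow> bool" where
  "individually_quasi_leontief I X r u \<longleftrightarrow>
    (\<forall>j\<in>I. \<forall>z\<in>PiE (I - {j}) X. quasi_leontief (X j) (r j) (partial_function_at u j z))"

definition efficient ::
    "'i set \<Rightarrow> ('i \<Rightarrow> 'a set) \<Rightarrow> ('i \<Rightarrow> 'a rel) \<Rightarrow> (('i \<Rightarrow> 'a) \<Rightarrow> 'l::linorder) \<Rightarrow> ('i \<Rightarrow> 'a) \<Rightarrow> bool" where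
  "efficient I X r u x \<longleftrightarrow>
    x \<in> PiE I X \<and>
    (\<forall>x'\<in>PiE I X. u x' \<ge> u x \<and> (x', x) \<in> prod_order I X r \<longrightarrow> x' = x)"

definition comprehensive :: "'a set \<Rightarrow> 'a rel \<Rightarrow> 'a set \<Rightarrow> bool" where
  "comprehensive Y r S \<longleftrightarrow> S \<subseteq> Y \<and> (\<forall>x'\<in>S. \<forall>x\<in>Y. (x, x') \<in> r \<longrightarrow> x \<in> S)"

definition argmax_set :: "('a \<Rightarrow> 'l::linorder) \<Rightarrow> 'a set \<Rightarrow> 'a set" where
  "argmax_set u S = {x\<in>S. \<forall>x'\<in>S. u x \<ge> u x'}"

end

theory Submission
  imports Defs
begin

text \<open>
  A quasi-Leontief function is isotone, so an individually quasi-Leontief \<open>u\<close> on a finite product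
  is isotone. Starting from any point, lower the coordinates one at a time, replacing the
  \<open>j\<close>-th one by the least value that keeps the utility at least as large. By isotonicity, lowering
  other coordinates later does not destroy the leastness of the \<open>j\<close>-th one; and a point all of
  whose coordinates are least in this sense is efficient. Comprehensiveness keeps
  the lowered point in \<open>S\<close>.
\<close>

text \<open>The upper level set of \<open>v\<close> at \<open>s\<close> contains \<open>s\<close>
  and is the set of all points above some \<open>y0\<close>; by transitivity it also contains
  everything above \<open>s\<close>.\<close>

lemma quasi_leontief_mono:
  assumes "partial_order_on Y r" "quasi_leontief Y r v" "s \<in> Y" "t \<in> Y" "(s, t) \<in> r"
  shows "v s \<le> v t"
proof -
  obtain y0 where y0: "{y'\<in>Y. v y' \<ge> v s} = {y'\<in>Y. (y0, y') \<in> r}"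
    using assms(2,3) unfolding quasi_leontief_def by blast
  then have "(y0, s) \<in> r" using assms(3) by blast
  then have "(y0, t) \<in> r"
    using assms(1,5) unfolding partial_order_on_def preorder_on_def by (meson transD)
  then show ?thesis using y0 assms(4) by blast
qed

lemma individually_quasi_leontief_slice:
  assumes "individually_quasi_leontief I X r u" "j \<in> I" "z \<in> PiE I X"
  shows "quasi_leontief (X j) (r j) (\<lambda>t. u (z(j := t)))"
proof -
  \<comment> \<open>Elements of \<open>PiE\<close> are \<open>undefined\<close> off the index set,
    so this update is the deletion of the coordinate \<open>j\<close>. A later update at
    \<open>j\<close> overwrites the default.\<close>
  have "z(j := undefined) \<in> PiE (I - {j}) X"
    using assms(3) by (auto simp: PiE_iff extensional_def)
  then have "quasi_leontief (X j) (r j) (partial_function_at u j (z(j := undefined)))"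
    using assms(1,2) unfolding individually_quasi_leontief_def by blast
  then show ?thesis by (simp add: partial_function_at_def)
qed

lemma PiE_fun_upd_same:
  assumes "z \<in> PiE I X" "j \<in> I" "t \<in> X j"
  shows "z(j := t) \<in> PiE I X"
  using assms by (auto simp: PiE_iff extensional_def)

text \<open>Pass from \<open>x\<close> to \<open>y\<close> through the hybrids
  \<open>override_on x y J\<close>, which agree with \<open>y\<close> on \<open>J\<close> and with
  \<open>x\<close> elsewhere. Enlarging \<open>J\<close> by one index moves within a single slice,
  where isotonicity is known; finiteness of \<open>I\<close> lets the chain reach
  \<open>y\<close>.\<close>

lemma individually_quasi_leontief_mono:
  assumes "finite I" "\<And>i. i \<in> I \<Longrightarrow> partial_order_on (X i) (r i)"
    and iql: "individually_quasi_leontief I X r u"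
    and xy: "(x, y) \<in> prod_order I X r"
  shows "u x \<le> u y"
proof -
  have x: "x \<in> PiE I X" and y: "y \<in> PiE I X" and le: "\<And>i. i \<in> I \<Longrightarrow> (x i, y i) \<in> r i"
    using xy by (auto simp: prod_order_def)
  have "u x \<le> u (override_on x y J)" if "finite J" "J \<subseteq> I" for J
    using that
  proof (induction J)
    case empty
    then show ?case by simp
  next
    case (insert j J)
    let ?z = "override_on x y J"
    \<comment> \<open>Since \<open>j\<close> is not yet in \<open>J\<close>, the hybrid still
      carries \<open>x j\<close> there, so both ends of the move are updates of \<open>?z\<close> at
      \<open>j\<close>.\<close>
    have j: "j \<in> I" and z: "?z \<in> PiE I X" and zj: "?z j = x j"
      using insert x y by (auto simp: PiE_iff extensional_def override_on_def)
    have "u (?z(j := x j)) \<le> u (?z(j := y j))"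
      using quasi_leontief_mono[OF assms(2)[OF j] individually_quasi_leontief_slice[OF iql j z]]
        le[OF j] x y j by (blast dest: PiE_mem)
    moreover have "?z(j := x j) = ?z" using zj by auto
    moreover have "?z(j := y j) = override_on x y (insert j J)"
      by (auto simp: override_on_def)
    ultimately show ?case using insert by auto
  qed
  from this[OF \<open>finite I\<close>] have "u x \<le> u (override_on x y I)" by simp
  moreover have "override_on x y I = y"
    using x y by (auto simp: override_on_def PiE_iff extensional_def)
  ultimately show ?thesis by simp
qed

lemma prod_order_trans:
  assumes "\<And>i. i \<in> I \<Longrightarrow> partial_order_on (X i) (r i)"
    and "(x, y) \<in> prod_order I X r" "(y, z) \<in> prod_order I X r"
  shows "(x, z) \<in> prod_order I X r"
  using assms unfolding prod_order_def partial_order_on_def preorder_on_def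
  by (simp, meson transD)

lemma prod_order_refl:
  assumes "\<And>i. i \<in> I \<Longrightarrow> partial_order_on (X i) (r i)" "x \<in> PiE I X"
  shows "(x, x) \<in> prod_order I X r"
  using assms unfolding prod_order_def partial_order_on_def preorder_on_def refl_on_def
  by (auto dest: PiE_mem)

lemma prod_order_fun_upd:
  assumes "\<And>i. i \<in> I \<Longrightarrow> partial_order_on (X i) (r i)"
    and "(x, y) \<in> prod_order I X r" "j \<in> I" "s \<in> X j" "t \<in> X j" "(s, t) \<in> r j"
  shows "(x(j := s), y(j := t)) \<in> prod_order I X r"
  using assms by (auto simp: prod_order_def intro: PiE_fun_upd_same)

text \<open>\<open>J\<close> collects the coordinates already lowered; the induction has to preserve
  their leastness while one more is lowered.\<close>

lemma exists_coordinatewise_least_below: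
  assumes "finite I" and po: "\<And>i. i \<in> I \<Longrightarrow> partial_order_on (X i) (r i)"
    and iql: "individually_quasi_leontief I X r u"
    and x: "x \<in> PiE I X" and "finite J" "J \<subseteq> I"
  shows "\<exists>y. (y, x) \<in> prod_order I X r \<and> u y \<ge> u x \<and>
    (\<forall>j\<in>J. \<forall>t\<in>X j. u (y(j := t)) \<ge> u y \<longrightarrow> (y j, t) \<in> r j)"
  using \<open>finite J\<close> \<open>J \<subseteq> I\<close>
proof (induction J)
  case empty
  then show ?case using prod_order_refl[OF po x] by auto
next
  case (insert j J)
  then obtain y where yx: "(y, x) \<in> prod_order I X r" and uy: "u y \<ge> u x"
    and least: "\<And>i t. i \<in> J \<Longrightarrow> t \<in> X i \<Longrightarrow> u (y(i := t)) \<ge> u y \<Longrightarrow> (y i, t) \<in> r i"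
    by blast
  have j: "j \<in> I" and y: "y \<in> PiE I X" and yj: "y j \<in> X j"
    using insert yx by (auto simp: prod_order_def)
  \<comment> \<open>The new coordinate \<open>s\<close> is the least element of the upper level set,
    at \<open>y j\<close>, of the slice of \<open>u\<close> through \<open>y\<close> in direction
    \<open>j\<close>.\<close>
  obtain s where s: "s \<in> X j"
    and lev: "{t\<in>X j. u (y(j := t)) \<ge> u (y(j := y j))} = {t\<in>X j. (s, t) \<in> r j}"
    using individually_quasi_leontief_slice[OF iql j y] yj unfolding quasi_leontief_def by blast
  let ?y' = "y(j := s)"
  have refl: "\<And>i t. i \<in> I \<Longrightarrow> t \<in> X i \<Longrightarrow> (t, t) \<in> r i"
    using po unfolding partial_order_on_def preorder_on_def refl_on_def by blast
  have sle: "(s, t) \<in> r j \<longleftrightarrow> u (y(j := t)) \<ge> u y" if "t \<in> X j" for t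
    using lev that by auto
  have uy': "u ?y' \<ge> u y" using sle[OF s] refl[OF j s] by blast
  have "(s, y j) \<in> r j" using sle[OF yj] by simp
  then have y'y: "(?y', y) \<in> prod_order I X r"
    using prod_order_fun_upd[OF po prod_order_refl[OF po y] j s yj] by simp
  have "(?y' i, t) \<in> r i"
    if i: "i \<in> insert j J" and t: "t \<in> X i" and ut: "u (?y'(i := t)) \<ge> u ?y'" for i t
  proof (cases "i = j")
    case True
    \<comment> \<open>The second update at \<open>j\<close> cancels the first, so \<open>t\<close>
      lies in the level set whose least element is \<open>s\<close>.\<close>
    then show ?thesis using sle[of t] t ut uy' by auto
  next
    case False
    have iI: "i \<in> I" and iJ: "i \<in> J" using i insert.prems False by auto
    \<comment> \<open>Raising coordinate \<open>j\<close> from \<open>s\<close> back to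
      \<open>y j\<close> does not lower the utility, so \<open>t\<close> already competes with
      \<open>y i\<close> at the old point \<open>y\<close>, where leastness is known.\<close>
    have "u (?y'(i := t)) \<le> u (y(i := t))"
      by (rule individually_quasi_leontief_mono[OF \<open>finite I\<close> po iql
            prod_order_fun_upd[OF po y'y iI t t refl[OF iI t]]])
    then have "(y i, t) \<in> r i" using least[OF iJ t] ut uy' by auto
    then show ?thesis using False by simp
  qed
  moreover have "(?y', x) \<in> prod_order I X r" by (rule prod_order_trans[OF po y'y yx])
  moreover have "u ?y' \<ge> u x" using uy uy' by simp
  ultimately show ?case by blast
qed

text \<open>Let \<open>x\<close> be below \<open>y\<close> with at least its utility. Replacing only
  the \<open>i\<close>-th coordinate of \<open>y\<close> by \<open>x i\<close> gives a point still
  above \<open>x\<close>, hence of utility at least \<open>u y\<close>. Leastness then puts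
  \<open>y i\<close> below \<open>x i\<close>, and antisymmetry gives equality.\<close>

lemma efficient_if_coordinatewise_least:
  assumes "finite I" and po: "\<And>i. i \<in> I \<Longrightarrow> partial_order_on (X i) (r i)"
    and iql: "individually_quasi_leontief I X r u"
    and y: "y \<in> PiE I X"
    and least: "\<And>j t. j \<in> I \<Longrightarrow> t \<in> X j \<Longrightarrow> u (y(j := t)) \<ge> u y \<Longrightarrow> (y j, t) \<in> r j"
  shows "efficient I X r u y"
  unfolding efficient_def
proof (intro conjI ballI impI)
  show "y \<in> PiE I X" by (fact y)
next
  fix x assume x: "x \<in> PiE I X" and "u x \<ge> u y \<and> (x, y) \<in> prod_order I X r"
  then have ux: "u x \<ge> u y" and xy: "(x, y) \<in> prod_order I X r" by auto
  show "x = y"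
  proof (rule PiE_ext[OF x y])
    fix i assume i: "i \<in> I"
    have xi: "x i \<in> X i" using x i by auto
    have xx: "(x i, x i) \<in> r i"
      using po[OF i] xi unfolding partial_order_on_def preorder_on_def refl_on_def by blast
    \<comment> \<open>The left update is trivial: it writes \<open>x\<close> in the form in which
      both points receive the same value at \<open>i\<close>.\<close>
    have "(x(i := x i), y(i := x i)) \<in> prod_order I X r"
      by (rule prod_order_fun_upd[OF po xy i xi xi xx])
    then have "u x \<le> u (y(i := x i))"
      using individually_quasi_leontief_mono[OF \<open>finite I\<close> po iql] by simp
    then have "(y i, x i) \<in> r i" using least[OF i xi] ux by auto
    moreover have "(x i, y i) \<in> r i" using xy i by (auto simp: prod_order_def)
    ultimately show "x i = y i"
      using po[OF i] unfolding partial_order_on_def by (blast dest: antisymD)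
  qed
qed

theorem theorem3p1p5:
  fixes n :: nat
    and X :: "nat \<Rightarrow> 'a set"
    and r :: "nat \<Rightarrow> 'a rel"
    and u :: "(nat \<Rightarrow> 'a) \<Rightarrow> 'l::linorder"
    and S :: "nat \<Rightarrow> 'a set"
  assumes "\<And>i. i \<in> {1..n} \<Longrightarrow> partial_order_on (X i) (r i)"
    and "individually_quasi_leontief {1..n} X r u"
    and "\<And>i. i \<in> {1..n} \<Longrightarrow> comprehensive (X i) (r i) (S i)"
    and "argmax_set u (PiE {1..n} S) \<noteq> {}"
  shows "\<forall>xstar \<in> argmax_set u (PiE {1..n} S).
    \<exists>xflat \<in> argmax_set u (PiE {1..n} S).
      efficient {1..n} X r u xflat \<and> (xflat, xstar) \<in> prod_order {1..n} X r"
proof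
  let ?I = "{1..n}"
  fix x assume "x \<in> argmax_set u (PiE ?I S)"
  then have xS: "x \<in> PiE ?I S" and max: "\<And>x'. x' \<in> PiE ?I S \<Longrightarrow> u x' \<le> u x"
    by (auto simp: argmax_set_def)
  have x: "x \<in> PiE ?I X"
    using xS assms(3) unfolding comprehensive_def PiE_iff by blast
  obtain y where yx: "(y, x) \<in> prod_order ?I X r" and uy: "u y \<ge> u x"
    and least: "\<And>j t. j \<in> ?I \<Longrightarrow> t \<in> X j \<Longrightarrow> u (y(j := t)) \<ge> u y \<Longrightarrow> (y j, t) \<in> r j"
    using exists_coordinatewise_least_below[of ?I X r u x ?I] assms(1,2) x by blast
  have y: "y \<in> PiE ?I X" using yx by (simp add: prod_order_def)
  have "y i \<in> S i" if "i \<in> ?I" for i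
    using assms(3)[OF that] PiE_mem[OF xS that] PiE_mem[OF y that] yx that
    unfolding comprehensive_def prod_order_def by blast
  then have "y \<in> PiE ?I S" using y by (simp add: PiE_iff)
  \<comment> \<open>Within the product of the \<open>S i\<close>, the utility of \<open>y\<close> is
    at least the maximum \<open>u x\<close>, so \<open>y\<close> is a maximizer too.\<close>
  then have "y \<in> argmax_set u (PiE ?I S)"
    using max uy by (auto simp: argmax_set_def intro: order_trans)
  moreover have "efficient ?I X r u y"
    by (rule efficient_if_coordinatewise_least[OF _ assms(1,2) y least]) simp_all
  ultimately show "\<exists>y \<in> argmax_set u (PiE ?I S).
      efficient ?I X r u y \<and> (y, x) \<in> prod_order ?I X r"
    using yx by blast
qed

end
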